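(* Let $p$ be a prime number such that $p-2$ is also prime and $p \equiv 7 \pmod 8$. Let $E_p$ be the elliptic curve over $\mathbb{Q}$ defined by \[ E_p : y^2 = x(x-p)(x-2). \] Then $\operatorname{rank} E_p(\mathbb{Q}) = 0$. In particular, \[ E_p(\mathbb{Q}) \cong \mathbb{Z}/2\mathbb{Z} \times \mathbb{Z}/2\mathbb{Z}. \]
   Context: By the Mordell–Weil theorem, $E_p(\mathbb{Q}) \cong \mathbb{Z}^r \oplus E_p(\mathbb{Q})_{\mathrm{tors}}$ with $r \geq 0$ finite; $r$ is the rank of $E_p$. *)

theory Defs
  imports
    "HOL-Algebra.Product_Groups"
    "HOL-Computational_Algebra.Polynomial"
    "HOL-Computational_Algebra.Primes"
    "HOL-Number_Theory.Cong"
begin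

section \<open>Rank of an abelian group\<close>

definition torsion_carrier :: "('a, 'b) monoid_scheme \<Rightarrow> 'a set" where
  "torsion_carrier G = {x \<in> carrier G. \<exists>n::nat. n > 0 \<and> x [^]\<^bsub>G\<^esub> n = \<one>\<^bsub>G\<^esub>}"

definition torsion_group :: "('a, 'b) monoid_scheme \<Rightarrow> ('a, 'b) monoid_scheme" where
  "torsion_group G = G\<lparr>carrier := torsion_carrier G\<rparr>"

text \<open>The exponent \<open>r\<close> in a decomposition of \<open>G\<close> as \<open>\<int>\<^sup>r\<close> times its torsion subgroup. It is
  unique when it exists (\<open>\<int>\<^sup>r\<close> is then isomorphic to \<open>G\<close> modulo torsion); it exists for every
  finitely generated abelian group. If there is no such \<open>r\<close>, the value is unspecified.\<close>

definition group_rank :: "('a, 'b) monoid_scheme \<Rightarrow> nat" where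
  "group_rank G =
     (THE r. G \<cong> product_group {..<r} (\<lambda>_. integer_group) \<times>\<times> torsion_group G)"

section \<open>The group of points of \<open>y\<^sup>2 = f(x)\<close>\<close>

text \<open>Throughout, \<open>f\<close> is meant to be a monic cubic without multiple roots. \<open>Infinity\<close> is the
  single point at infinity of the projective closure.\<close>

datatype 'a ec_point = Infinity | Affine 'a 'a

definition ec_points :: "'a::field_char_0 poly \<Rightarrow> 'a ec_point set" where
  "ec_points f = insert Infinity {Affine x y |x y. y\<^sup>2 = poly f x}"

text \<open>Chord-and-tangent addition. The line through the two points (the tangent if they coincide)
  has slope \<open>l\<close>; substituting it into \<open>y\<^sup>2 = f(x)\<close> shows that the three intersection abscissae add
  up to \<open>l\<^sup>2 - coeff f 2\<close>. The third intersection point is then reflected in the \<open>x\<close>-axis. For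
  points on the curve, equal abscissae and \<open>y1 \<noteq> - y2\<close> force \<open>y1 = y2 \<noteq> 0\<close>.\<close>

fun ec_add :: "'a::field_char_0 poly \<Rightarrow> 'a ec_point \<Rightarrow> 'a ec_point \<Rightarrow> 'a ec_point" where
  "ec_add f Infinity Q = Q"
| "ec_add f P Infinity = P"
| "ec_add f (Affine x1 y1) (Affine x2 y2) =
     (if x1 = x2 \<and> y1 = - y2 then Infinity
      else let l = (if x1 = x2 then poly (pderiv f) x1 / (2 * y1) else (y2 - y1) / (x2 - x1));
               x3 = l\<^sup>2 - coeff f 2 - x1 - x2
           in Affine x3 (l * (x1 - x3) - y1))"

definition ec_group :: "'a::field_char_0 poly \<Rightarrow> 'a ec_point monoid" where
  "ec_group f = \<lparr>carrier = ec_points f, monoid.mult = ec_add f, one = Infinity\<rparr>"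

section \<open>The curves \<open>E\<^sub>p: y\<^sup>2 = x(x - p)(x - 2)\<close>\<close>

definition E_cubic :: "nat \<Rightarrow> rat poly" where
  "E_cubic p = [:0, 1:] * [:- of_nat p, 1:] * [:-2, 1:]"

lemma poly_E_cubic: "poly (E_cubic p) x = x * (x - of_nat p) * (x - 2)"
  by (simp add: E_cubic_def algebra_simps)

lemma E_cubic_monic_cubic: "degree (E_cubic p) = 3" "lead_coeff (E_cubic p) = 1"
  by (simp_all add: E_cubic_def)

lemma E_cubic_no_multiple_root:
  assumes "p \<noteq> 0" "p \<noteq> 2" "poly (E_cubic p) x = 0"
  shows "poly (pderiv (E_cubic p)) x \<noteq> 0"
proof -
  have "of_nat p \<noteq> (0::rat)" "of_nat p \<noteq> (2::rat)"
    using assms(1,2) of_nat_eq_iff[of p 2, where ?'a = rat] by simp_all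
  moreover have "x = 0 \<or> x = of_nat p \<or> x = 2"
    using assms(3) by (simp add: poly_E_cubic)
  moreover have "poly (pderiv (E_cubic p)) x =
      (x - of_nat p) * (x - 2) + x * (x - 2) + x * (x - of_nat p)"
    by (simp add: E_cubic_def pderiv_pCons algebra_simps)
  ultimately show ?thesis
    by auto
qed

abbreviation E_group :: "nat \<Rightarrow> rat ec_point monoid" where
  "E_group p \<equiv> ec_group (E_cubic p)"

end

theory Submission
  imports Defs "HOL-Computational_Algebra.Nth_Powers" "HOL-Computational_Algebra.Squarefree"
begin

text \<open>Put \<open>q = p - 2\<close>. The abscissa of a rational point with \<open>y \<noteq> 0\<close> is positive and lies in one of
  the square classes \<open>1, 2, p, 2p\<close>, which are exactly those of the points of order at most 2. So after
  a translation the abscissa is a square \<open>u\<^sup>2/e\<^sup>2\<close>, and congruences modulo 8 leave only the case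
  \<open>u\<^sup>2 - 2e\<^sup>2 = v\<^sup>2\<close>, \<open>u\<^sup>2 - pe\<^sup>2 = w\<^sup>2\<close>. Parametrising the first equation by \<open>u = r\<^sup>2 + 2s\<^sup>2\<close>, \<open>e = 2rs\<close>
  turns the second one into \<open>A\<^sup>2 - w\<^sup>2 = 4pqs\<^sup>4\<close> with \<open>A = r\<^sup>2 - 2(p - 1)s\<^sup>2\<close>, where \<open>(A - w)/2\<close> and
  \<open>(A + w)/2\<close> are coprime. The resulting fourth powers \<open>m\<^sup>4\<close>, \<open>n\<^sup>4\<close> with \<open>s = mn\<close> give, again by
  congruences modulo 8, that \<open>m\<^sup>2 + qn\<^sup>2\<close> and \<open>m\<^sup>2 + pn\<^sup>2\<close> are squares: a solution of the same system
  with \<open>n < e\<close> in place of \<open>e\<close>. Hence every rational affine point has \<open>y = 0\<close>.\<close>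

section \<open>Squares and coprime factors\<close>

lemma square_mod_8_int: "(x::int)\<^sup>2 mod 8 \<in> {0, 1, 4}"
proof -
  have "x mod 8 \<in> {0, 1, 2, 3, 4, 5, 6, 7}"
    by auto
  moreover have "x\<^sup>2 mod 8 = (x mod 8)\<^sup>2 mod 8"
    by (simp add: power_mod)
  ultimately show ?thesis
    by auto
qed

lemma odd_square_mod_8_int: "x\<^sup>2 mod 8 = 1" if "odd x" for x :: int
proof -
  have "y mod 8 = 1" if "odd y" "y mod 8 \<in> {0, 1, 4}" for y :: int
    using that by auto presburger+
  then show ?thesis
    using that square_mod_8_int[of x] by simp
qed

text \<open>Serves to reduce the coefficients \<open>p\<close>, \<open>q\<close> and the squares
  modulo 8, so that only a finite check of residues remains.\<close>

lemma linear_combination_mod_eq: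
  fixes a b x y c :: int
  assumes "a mod c = a'" "b mod c = b'"
  shows "(a * x + b * y) mod c = (a' * (x mod c) + b' * (y mod c)) mod c"
  unfolding assms[symmetric] by (metis mod_add_eq mod_mult_eq)

lemma coprime_mult_eq_powerE:
  fixes a b c :: nat
  assumes "coprime a b" "a * b = c ^ k" "k > 0"
  obtains m n where "a = m ^ k" "b = n ^ k" "c = m * n" "coprime m n"
proof -
  have "is_nth_power k a" "is_nth_power k b"
    using is_nth_power_mult_coprime_nat_iff[OF assms(1), of k] assms(2) by auto
  then obtain m n where mn: "a = m ^ k" "b = n ^ k"
    by (auto elim!: is_nth_powerE)
  then have "c ^ k = (m * n) ^ k"
    using assms(2) by (simp add: power_mult_distrib)
  then have "c = m * n"
    using assms(3) power_eq_iff_eq_base by blast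
  moreover have "coprime m n"
    using assms mn by simp
  ultimately show ?thesis
    using that mn by blast
qed

text \<open>Take the squarefree part of \<open>a\<close> for \<open>d\<close>. A prime of odd
  multiplicity in \<open>a\<close> also has odd multiplicity in \<open>b\<close>, as the two add up
  to an even number; so it divides both, hence \<open>l\<close>. Multiplicities in the squarefree
  part are at most 1.\<close>

lemma square_class_nat:
  fixes a b z l :: nat
  assumes "a * b = z\<^sup>2" "z > 0" "l > 0"
    and common: "\<And>r. prime r \<Longrightarrow> r dvd a \<Longrightarrow> r dvd b \<Longrightarrow> r dvd l"
  obtains d v where "d dvd l" "a = d * v\<^sup>2"
proof
  have nz: "a \<noteq> 0" "b \<noteq> 0"
    using assms by (auto intro!: Nat.gr0I)
  show "squarefree_part a dvd l"
  proof (rule multiplicity_le_imp_dvd)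
    fix r :: nat assume r: "prime r"
    show "multiplicity r (squarefree_part a) \<le> multiplicity r l"
    proof (cases "odd (multiplicity r a)")
      case True
      have "multiplicity r a + multiplicity r b = 2 * multiplicity r z"
        using r nz assms(1,2)
        by (metis prime_elem_multiplicity_mult_distrib prime_elem_multiplicity_power_distrib
            prime_imp_prime_elem not_gr_zero)
      then have "odd (multiplicity r b)"
        using True by presburger
      then have "r dvd a" "r dvd b"
        using True by (metis even_zero not_dvd_imp_multiplicity_0)+
      then have "r dvd l"
        using common r by blast
      then have "multiplicity r l \<ge> 1"
        using r assms(3) by (metis Suc_leI One_nat_def not_prime_unit prime_multiplicity_gt_zero_iff
            prime_imp_prime_elem bot_nat_0.not_eq_extremum)
      then show ?thesis
        using prime_multiplicity_squarefree_part_le_Suc_0[of r a] r by simp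
    next
      case False
      then show ?thesis
        using r nz by (simp add: prime_multiplicity_squarefree_part odd_iff_mod_2_eq_one even_iff_mod_2_eq_zero)
    qed
  qed (use assms in simp_all)
  show "a = squarefree_part a * (square_part a)\<^sup>2"
    by (rule squarefree_decompose)
qed

text \<open>Passes to absolute values, so the sign of \<open>a\<close> must be settled separately
  wherever this is applied.\<close>

lemma square_class_int:
  fixes a b z l :: int
  assumes "a * b = z\<^sup>2" "z \<noteq> 0" "l > 0"
    and common: "\<And>r. prime r \<Longrightarrow> r dvd a \<Longrightarrow> r dvd b \<Longrightarrow> r dvd l"
  obtains d v where "d dvd l" "d > 0" "\<bar>a\<bar> = d * v\<^sup>2"
proof -
  have "nat \<bar>a\<bar> * nat \<bar>b\<bar> = (nat \<bar>z\<bar>)\<^sup>2"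
    by (metis assms(1) nat_abs_mult_distrib power2_eq_square)
  moreover have "r dvd nat l" if "prime r" "r dvd nat \<bar>a\<bar>" "r dvd nat \<bar>b\<bar>" for r :: nat
  proof -
    have "int r dvd l"
      using that common[of "int r"] assms(1) by (simp add: int_dvd_int_iff[symmetric])
    then show ?thesis
      using assms(3) by (metis int_dvd_int_iff int_nat_eq less_imp_le)
  qed
  ultimately obtain d v where dv: "d dvd nat l" "nat \<bar>a\<bar> = d * v\<^sup>2"
    using square_class_nat[of "nat \<bar>a\<bar>" "nat \<bar>b\<bar>" "nat \<bar>z\<bar>" "nat l"] assms(2,3) by auto
  have "int d dvd l" "d > 0"
    using dv(1) assms(3) by (auto simp: nat_dvd_iff dvd_imp_le intro!: Nat.gr0I)
      (metis int_dvd_int_iff int_nat_eq less_imp_le)+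
  moreover have "\<bar>a\<bar> = int d * (int v)\<^sup>2"
    using dv(2) by (metis abs_ge_zero int_nat_eq of_nat_mult of_nat_power)
  ultimately show ?thesis
    using that[of "int d" "int v"] by simp
qed

text \<open>The primes \<open>p\<close> and \<open>q\<close> each divide \<open>x\<close> or
  \<open>y\<close>; the cofactors are coprime with product \<open>s ^ 4\<close>, hence fourth
  powers. Only the sum is recorded: it ignores the order of \<open>x\<close> and \<open>y\<close>,
  so four distributions become two shapes.\<close>

lemma coprime_mult_eq_two_primes_times_fourth_power:
  fixes x y p q s :: nat
  assumes "coprime x y" "x * y = p * q * s ^ 4" "prime p" "prime q" "p \<noteq> q"
  obtains m n where "s = m * n" "coprime m n"
    "x + y = m ^ 4 + p * q * n ^ 4 \<or> x + y = p * m ^ 4 + q * n ^ 4"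
proof -
  note result = that
  have pos: "p > 0" "q > 0" using assms by (auto simp: prime_gt_0_nat)
  have main: thesis if h: "coprime a b" "a * b = s ^ 4"
     "x + y = a + p * q * b \<or> x + y = p * a + q * b" for a b
  proof -
    obtain m n where "a = m ^ 4" "b = n ^ 4" "s = m * n" "coprime m n"
      using coprime_mult_eq_powerE[OF h(1,2)] by (metis zero_less_numeral)
    then show thesis
      using h(3) result by blast
  qed
  have "coprime p q" using assms by (simp add: primes_coprime)
  consider "p * q dvd x" | "p * q dvd y" | "p dvd x" "q dvd y" | "q dvd x" "p dvd y"
    using assms \<open>coprime p q\<close> by (metis prime_dvd_mult_iff divides_mult dvd_triv_left dvd_mult2 dvd_triv_right)
  then show thesis
  proof cases
    case 1
    then obtain b where b: "x = p * q * b" by auto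
    show ?thesis
      by (rule main[of y b]) (use b pos assms in \<open>auto simp: coprime_commute mult_ac\<close>)
  next
    case 2
    then obtain b where b: "y = p * q * b" by auto
    show ?thesis
      by (rule main[of x b]) (use b pos assms in \<open>auto simp: coprime_commute mult_ac\<close>)
  next
    case 3
    obtain a where a: "x = p * a" using 3(1) by (rule dvdE)
    obtain b where b: "y = q * b" using 3(2) by (rule dvdE)
    show ?thesis
      by (rule main[of a b]) (use a b pos assms in \<open>auto simp: coprime_commute mult_ac\<close>)
  next
    case 4
    obtain a where a: "y = p * a" using 4(2) by (rule dvdE)
    obtain b where b: "x = q * b" using 4(1) by (rule dvdE)
    show ?thesis
      by (rule main[of a b]) (use a b pos assms in \<open>auto simp: coprime_commute mult_ac\<close>)
  qed
qed

section \<open>Infinite descent\<close>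

text \<open>Writing \<open>u = v + 2 * k\<close> and \<open>e = 2 * f\<close> turns the equation
  into \<open>k * (v + k) = 2 * f\<^sup>2\<close> with coprime factors, so one is a square and the
  other twice a square; \<open>u\<close> is their sum. The square is \<open>r\<^sup>2\<close>, odd
  because \<open>u\<close> is.\<close>

lemma square_eq_square_plus_two_squares:
  fixes u v e :: nat
  assumes "u\<^sup>2 = v\<^sup>2 + 2 * e\<^sup>2" "coprime u e"
  obtains r s where "u = r\<^sup>2 + 2 * s\<^sup>2" "e = 2 * r * s" "odd r" "coprime r s"
proof -
  have par: "even u \<longleftrightarrow> even v"
    using assms(1) by (metis even_add even_mult_iff even_numeral even_power pos2)
  have "odd u"
  proof
    assume "even u"
    then obtain k l where "u = 2 * k" "v = 2 * l"
      using par by (metis evenE)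
    then have "2 * (2 * k\<^sup>2) = 2 * (2 * l\<^sup>2 + e\<^sup>2) "
      using assms(1) by (simp add: power_mult_distrib)
    then have "even (e\<^sup>2)"
      by (metis dvd_triv_left even_add nat_mult_eq_cancel1 zero_less_numeral)
    then have "even e"
      by simp
    then show False
      using \<open>even u\<close> assms(2) coprime_common_divisor odd_one by blast
  qed
  have "v \<le> u"
    using assms(1) by (metis le_add1 power2_nat_le_imp_le power_mono_iff pos2 zero_le)
  moreover have "even (u - v)"
    using par by simp
  ultimately obtain k where k: "u = v + 2 * k"
    by (metis evenE le_add_diff_inverse)
  have ke: "2 * (k * (v + k)) = e\<^sup>2"
    using assms(1) k by (simp add: power2_eq_square algebra_simps)
  have "coprime k (v + k)"
  proof (rule coprimeI)
    fix d assume d: "d dvd k" "d dvd v + k"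
    then have "d dvd e\<^sup>2"
      using ke by (metis dvd_mult dvd_mult2)
    moreover have "d dvd u"
      using d k by (metis add.assoc dvd_add mult_2)
    moreover have "coprime u (e\<^sup>2)"
      using assms(2) by simp
    ultimately show "is_unit d"
      using coprime_common_divisor by blast
  qed
  obtain f where f: "e = 2 * f"
    using ke by (metis dvd_triv_left even_power evenE)
  have kf: "k * (v + k) = 2 * f\<^sup>2"
    using ke f by (simp add: power2_eq_square)
  show ?thesis
  proof (cases "even k")
    case True
    then obtain k' where k': "k = 2 * k'" by auto
    have "coprime k' (v + k)" "k' * (v + k) = f\<^sup>2"
      using \<open>coprime k (v + k)\<close> kf k' by auto
    then obtain m n where mn: "k' = m\<^sup>2" "v + k = n\<^sup>2" "f = m * n" "coprime m n"
      using coprime_mult_eq_powerE[of k' "v + k" f 2] by (metis pos2)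
    have "u = n\<^sup>2 + 2 * m\<^sup>2" using k k' mn by simp
    then show ?thesis
      using that[of n m] mn f \<open>odd u\<close> by (simp add: coprime_commute mult_ac)
  next
    case False
    then have "even (v + k)"
      using kf by (metis dvd_triv_left even_mult_iff)
    then obtain k' where k': "v + k = 2 * k'" by (rule evenE)
    have "coprime k k'" "k * k' = f\<^sup>2"
      using \<open>coprime k (v + k)\<close> kf k' by auto
    then obtain m n where mn: "k = m\<^sup>2" "k' = n\<^sup>2" "f = m * n" "coprime m n"
      using coprime_mult_eq_powerE[of k k' f 2] by (metis pos2)
    have "u = m\<^sup>2 + 2 * n\<^sup>2" using k k' mn by simp
    then show ?thesis
      using that[of m n] mn f \<open>odd u\<close> by (simp add: mult_ac)
  qed
qed

lemma coprime_square_factors: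
  fixes a b r :: int
  assumes "a * b = r\<^sup>2" "coprime a b" "a > 0" "b > 0"
  obtains \<alpha> \<beta> where "a = \<alpha>\<^sup>2" "b = \<beta>\<^sup>2"
proof -
  have "nat a * nat b = (nat \<bar>r\<bar>)\<^sup>2"
    using assms by (metis abs_ge_zero int_nat_eq less_imp_le nat_mult_distrib nat_power_eq power2_abs)
  moreover have "coprime (nat a) (nat b)"
    using assms by (metis coprime_int_iff int_nat_eq less_imp_le)
  ultimately obtain m n where "nat a = m\<^sup>2" "nat b = n\<^sup>2"
    using coprime_mult_eq_powerE[of "nat a" "nat b" "nat \<bar>r\<bar>" 2] by (metis pos2)
  then have "a = (int m)\<^sup>2" "b = (int n)\<^sup>2"
    using assms by (metis int_nat_eq less_imp_le of_nat_power)+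
  then show ?thesis
    using that by blast
qed

text \<open>According to the shape and sign of \<open>c\<close>, \<open>r\<^sup>2\<close> is \<open>(m\<^sup>2 + p n\<^sup>2)(m\<^sup>2 + q n\<^sup>2)\<close>,
  \<open>(p n\<^sup>2 - m\<^sup>2)(m\<^sup>2 - q n\<^sup>2)\<close>, \<open>(p m\<^sup>2 + q n\<^sup>2)(m\<^sup>2 + n\<^sup>2)\<close> or \<open>(p m\<^sup>2 - q n\<^sup>2)(n\<^sup>2 - m\<^sup>2)\<close>,
  with coprime factors; modulo 8 only the first product can be a square.\<close>

lemma descent_quartic:
  fixes p q m n r :: int
  assumes "p = q + 2" "p mod 8 = 7" "q > 0" "odd r" "coprime m n" "n \<noteq> 0"
    and eq: "r\<^sup>2 = 2 * (p - 1) * (m * n)\<^sup>2 + c"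
    and c: "\<bar>c\<bar> = m ^ 4 + p * q * n ^ 4 \<or> \<bar>c\<bar> = p * m ^ 4 + q * n ^ 4"
  obtains u v where "u\<^sup>2 = v\<^sup>2 + 2 * n\<^sup>2" "u\<^sup>2 = m\<^sup>2 + p * n\<^sup>2"
proof -
  \<comment> \<open>A common divisor is odd because \<open>r\<close> is, and the two linear
    identities make it divide \<open>m\<^sup>2\<close> and \<open>n\<^sup>2\<close>. The
    coefficients are left free since each of the four factorisations supplies its own.\<close>
  have cop: "coprime a b"
    if ab: "a * b = r\<^sup>2" and lin: "x * a + y * b = 2 * m\<^sup>2" "z * a + t * b = 2 * n\<^sup>2" for a b x y z t
  proof (rule coprimeI)
    fix d assume d: "d dvd a" "d dvd b"
    then have "odd d"
      using ab \<open>odd r\<close> by (metis dvd_mult2 dvd_trans even_power pos2)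
    then have "coprime d 2"
      by simp
    have "d dvd 2 * m\<^sup>2" "d dvd 2 * n\<^sup>2"
      using d lin by (metis dvd_add dvd_mult)+
    then have "d dvd m\<^sup>2" "d dvd n\<^sup>2"
      using \<open>coprime d 2\<close> coprime_dvd_mult_right_iff by blast+
    then show "is_unit d"
      using \<open>coprime m n\<close> by (meson coprime_common_divisor coprime_power_left_iff coprime_power_right_iff)
  qed
  \<comment> \<open>Coprime positive factors of an odd square are odd squares, hence both 1 modulo
    8.\<close>
  have fac: False if pos: "a > 0" "b > 0" and ab: "a * b = r\<^sup>2" and lin: "x * a + y * b = 2 * m\<^sup>2" "z * a + t * b = 2 * n\<^sup>2"
     and mod: "\<not> (a mod 8 = 1 \<and> b mod 8 = 1)" for a b x y z t
  proof -
    obtain \<alpha> \<beta> where "a = \<alpha>\<^sup>2" "b = \<beta>\<^sup>2"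
      using coprime_square_factors[OF ab cop[OF ab lin] pos] by blast
    moreover have "odd a" "odd b"
      using ab \<open>odd r\<close> by (metis even_mult_iff even_power pos2)+
    ultimately show False
      using mod odd_square_mod_8_int by simp
  qed
  have "r \<noteq> 0"
    using \<open>odd r\<close> by auto
  then have nz: "r\<^sup>2 > 0" "n\<^sup>2 > 0"
    using \<open>n \<noteq> 0\<close> by (simp_all only: zero_less_power2 not_False_eq_True)
  have odd_mn: "odd m \<or> odd n"
    using \<open>coprime m n\<close> by (metis coprime_common_divisor odd_one)
  have sq: "m\<^sup>2 mod 8 \<in> {0,1,4}" "n\<^sup>2 mod 8 \<in> {0,1,4}" "m\<^sup>2 mod 8 = 1 \<or> n\<^sup>2 mod 8 = 1"
    using odd_mn odd_square_mod_8_int square_mod_8_int by blast+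
  have pq8: "p mod 8 = 7" "q mod 8 = 5" "- q mod 8 = 3"
    using assms(1,2) by presburger+
  note alg = power2_eq_square power4_eq_xxxx algebra_simps
  from c consider "c = m ^ 4 + p * q * n ^ 4" | "c = - (m ^ 4 + p * q * n ^ 4)"
    | "c = p * m ^ 4 + q * n ^ 4" | "c = - (p * m ^ 4 + q * n ^ 4)"
    by linarith
  then show thesis
  proof cases
    case 1
    \<comment> \<open>\<open>p + q = 2 * (p - 1)\<close> is what makes the right-hand side factor,
      here and in the other cases.\<close>
    have ab: "(m\<^sup>2 + p * n\<^sup>2) * (m\<^sup>2 + q * n\<^sup>2) = r\<^sup>2"
      unfolding eq 1 assms(1) by (simp add: alg)
    have lin: "-q * (m\<^sup>2 + p * n\<^sup>2) + p * (m\<^sup>2 + q * n\<^sup>2) = 2 * m\<^sup>2"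
       "1 * (m\<^sup>2 + p * n\<^sup>2) + (-1) * (m\<^sup>2 + q * n\<^sup>2) = 2 * n\<^sup>2"
      unfolding assms(1) by (simp_all add: alg)
    then have pos: "m\<^sup>2 + p * n\<^sup>2 > 0" "m\<^sup>2 + q * n\<^sup>2 > 0"
      using nz assms(1,3) by (simp_all add: add_nonneg_pos)
    obtain u v where uv: "m\<^sup>2 + p * n\<^sup>2 = u\<^sup>2" "m\<^sup>2 + q * n\<^sup>2 = v\<^sup>2"
      using coprime_square_factors[OF ab cop[OF ab lin] pos] by blast
    have "m\<^sup>2 + p * n\<^sup>2 = m\<^sup>2 + q * n\<^sup>2 + 2 * n\<^sup>2"
      by (simp add: assms(1) algebra_simps)
    then show ?thesis
      unfolding uv by (rule that) (rule uv(1)[symmetric])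
  next
    case 2
    have ab: "(p * n\<^sup>2 - m\<^sup>2) * (m\<^sup>2 - q * n\<^sup>2) = r\<^sup>2"
      unfolding eq 2 assms(1) by (simp add: alg)
    have lin: "q * (p * n\<^sup>2 - m\<^sup>2) + p * (m\<^sup>2 - q * n\<^sup>2) = 2 * m\<^sup>2"
       "1 * (p * n\<^sup>2 - m\<^sup>2) + 1 * (m\<^sup>2 - q * n\<^sup>2) = 2 * n\<^sup>2"
      unfolding assms(1) by (simp_all add: alg)
    have "(p * n\<^sup>2 - m\<^sup>2) * (m\<^sup>2 - q * n\<^sup>2) > 0" "(p * n\<^sup>2 - m\<^sup>2) + (m\<^sup>2 - q * n\<^sup>2) > 0"
      unfolding ab lin(2)[unfolded mult_1] using nz by simp_all
    then have pos: "p * n\<^sup>2 - m\<^sup>2 > 0" "m\<^sup>2 - q * n\<^sup>2 > 0"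
      by (auto simp: zero_less_mult_iff)
    have "\<not> ((p * n\<^sup>2 - m\<^sup>2) mod 8 = 1 \<and> (m\<^sup>2 - q * n\<^sup>2) mod 8 = 1)"
    proof -
      have eq: "p * n\<^sup>2 - m\<^sup>2 = p * n\<^sup>2 + (- 1) * m\<^sup>2"
        "m\<^sup>2 - q * n\<^sup>2 = 1 * m\<^sup>2 + (- q) * n\<^sup>2"
        by simp_all
      have mod_eq: "(p * n\<^sup>2 - m\<^sup>2) mod 8 = (7 * (n\<^sup>2 mod 8) + 7 * (m\<^sup>2 mod 8)) mod 8"
        "(m\<^sup>2 - q * n\<^sup>2) mod 8 = (1 * (m\<^sup>2 mod 8) + 3 * (n\<^sup>2 mod 8)) mod 8"
        unfolding eq by (rule linear_combination_mod_eq; (rule pq8 | simp))+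
      have "\<not> ((7 * j + 7 * i) mod 8 = 1 \<and> (1 * i + 3 * j) mod 8 = 1)"
        if "i \<in> {0, 1, 4}" "j \<in> {0, 1, 4}" "i = 1 \<or> j = 1" for i j :: int
        using that by auto
      from this[OF sq] show ?thesis
        unfolding mod_eq .
    qed
    from fac[OF pos ab lin this] show ?thesis by blast
  next
    case 3
    have ab: "(p * m\<^sup>2 + q * n\<^sup>2) * (m\<^sup>2 + n\<^sup>2) = r\<^sup>2"
      unfolding eq 3 assms(1) by (simp add: alg)
    have lin: "1 * (p * m\<^sup>2 + q * n\<^sup>2) + (-q) * (m\<^sup>2 + n\<^sup>2) = 2 * m\<^sup>2"
       "(-1) * (p * m\<^sup>2 + q * n\<^sup>2) + p * (m\<^sup>2 + n\<^sup>2) = 2 * n\<^sup>2"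
      unfolding assms(1) by (simp_all add: alg)
    then have pos: "p * m\<^sup>2 + q * n\<^sup>2 > 0" "m\<^sup>2 + n\<^sup>2 > 0"
      using nz assms(1,3) by (simp_all add: add_nonneg_pos)
    have "\<not> ((p * m\<^sup>2 + q * n\<^sup>2) mod 8 = 1 \<and> (m\<^sup>2 + n\<^sup>2) mod 8 = 1)"
    proof -
      have eq: "m\<^sup>2 + n\<^sup>2 = 1 * m\<^sup>2 + 1 * n\<^sup>2"
        by simp
      have mod_eq: "(p * m\<^sup>2 + q * n\<^sup>2) mod 8 = (7 * (m\<^sup>2 mod 8) + 5 * (n\<^sup>2 mod 8)) mod 8"
        "(m\<^sup>2 + n\<^sup>2) mod 8 = (1 * (m\<^sup>2 mod 8) + 1 * (n\<^sup>2 mod 8)) mod 8"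
        unfolding eq by (rule linear_combination_mod_eq; (rule pq8 | simp))+
      have "\<not> ((7 * i + 5 * j) mod 8 = 1 \<and> (1 * i + 1 * j) mod 8 = 1)"
        if "i \<in> {0, 1, 4}" "j \<in> {0, 1, 4}" "i = 1 \<or> j = 1" for i j :: int
        using that by auto
      from this[OF sq] show ?thesis
        unfolding mod_eq .
    qed
    from fac[OF pos ab lin this] show ?thesis by blast
  next
    case 4
    have ab: "(p * m\<^sup>2 - q * n\<^sup>2) * (n\<^sup>2 - m\<^sup>2) = r\<^sup>2"
      unfolding eq 4 assms(1) by (simp add: alg)
    have lin: "1 * (p * m\<^sup>2 - q * n\<^sup>2) + q * (n\<^sup>2 - m\<^sup>2) = 2 * m\<^sup>2"
       "1 * (p * m\<^sup>2 - q * n\<^sup>2) + p * (n\<^sup>2 - m\<^sup>2) = 2 * n\<^sup>2"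
      unfolding assms(1) by (simp_all add: alg)
    have "(p * m\<^sup>2 - q * n\<^sup>2) * (n\<^sup>2 - m\<^sup>2) > 0"
      using ab nz by linarith
    \<comment> \<open>Two negative factors would make the left-hand side of the second identity in
      \<open>lin\<close> negative, while it equals \<open>2 * n\<^sup>2\<close>.\<close>
    moreover have "\<not> n\<^sup>2 - m\<^sup>2 < 0 \<or> \<not> p * m\<^sup>2 - q * n\<^sup>2 < 0"
      using lin(2) nz assms(1,3) by (smt (verit) mult_pos_neg zero_le_power2)
    ultimately have pos: "p * m\<^sup>2 - q * n\<^sup>2 > 0" "n\<^sup>2 - m\<^sup>2 > 0"
      by (auto simp: zero_less_mult_iff)
    have "\<not> ((p * m\<^sup>2 - q * n\<^sup>2) mod 8 = 1 \<and> (n\<^sup>2 - m\<^sup>2) mod 8 = 1)"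
    proof -
      have eq: "p * m\<^sup>2 - q * n\<^sup>2 = p * m\<^sup>2 + (- q) * n\<^sup>2"
        "n\<^sup>2 - m\<^sup>2 = 1 * n\<^sup>2 + (- 1) * m\<^sup>2"
        by simp_all
      have mod_eq: "(p * m\<^sup>2 - q * n\<^sup>2) mod 8 = (7 * (m\<^sup>2 mod 8) + 3 * (n\<^sup>2 mod 8)) mod 8"
        "(n\<^sup>2 - m\<^sup>2) mod 8 = (1 * (n\<^sup>2 mod 8) + 7 * (m\<^sup>2 mod 8)) mod 8"
        unfolding eq by (rule linear_combination_mod_eq; (rule pq8 | simp))+
      have "\<not> ((7 * i + 3 * j) mod 8 = 1 \<and> (1 * j + 7 * i) mod 8 = 1)"
        if "i \<in> {0, 1, 4}" "j \<in> {0, 1, 4}" "i = 1 \<or> j = 1" for i j :: int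
        using that by auto
      from this[OF sq] show ?thesis
        unfolding mod_eq .
    qed
    from fac[OF pos ab lin this] show ?thesis by blast
  qed
qed

text \<open>Strong induction on \<open>e\<close>: the parameters \<open>r\<close>, \<open>s\<close>
  of the first equation lead to a solution with a proper divisor \<open>n\<close> of
  \<open>e\<close> in its place. \<open>coprime u e\<close> is carried along because the
  parametrisation requires it.\<close>

lemma no_concordant_squares:
  fixes p q e u v w :: nat
  assumes pq: "prime p" "prime q" "p = q + 2" "p mod 8 = 7"
  shows "e > 0 \<Longrightarrow> coprime u e \<Longrightarrow> u\<^sup>2 = v\<^sup>2 + 2 * e\<^sup>2 \<Longrightarrow> u\<^sup>2 = w\<^sup>2 + p * e\<^sup>2 \<Longrightarrow> False"
proof (induction e arbitrary: u v w rule: less_induct)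
  case (less e)
  obtain r s where rs: "u = r\<^sup>2 + 2 * s\<^sup>2" "e = 2 * r * s" "odd r" "coprime r s"
    using square_eq_square_plus_two_squares[OF less.prems(3,2)] by blast
  have "s > 0" "r > 0"
    using less.prems(1) rs(2) by auto
  \<comment> \<open>Comes from completing the square in \<open>r\<^sup>2\<close>: after
    parametrisation \<open>w\<^sup>2\<close> is
    \<open>r ^ 4 - 4 * (p - 1) * r\<^sup>2 * s\<^sup>2 + 4 * s ^ 4\<close>, which falls short of
    \<open>A\<^sup>2\<close> by \<open>4 * p * q * s ^ 4\<close>.\<close>
  define A where "A = (int r)\<^sup>2 - 2 * (int p - 1) * (int s)\<^sup>2"
  have w: "(int w)\<^sup>2 = ((int r)\<^sup>2 + 2 * (int s)\<^sup>2)\<^sup>2 - int p * (2 * int r * int s)\<^sup>2"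
    using arg_cong[OF less.prems(4), of int] rs(1,2) by simp
  have Aw: "A\<^sup>2 - (int w)\<^sup>2 = 4 * (int p * int q * int s ^ 4)"
    unfolding w A_def pq(3) by (simp add: power2_eq_square power4_eq_xxxx algebra_simps)
  have "even (A\<^sup>2 - (int w)\<^sup>2)"
    unfolding Aw by simp
  then have "even (A - int w)"
    by (simp add: power2_eq_square)
  then obtain X where X: "A - int w = 2 * X"
    by (rule evenE)
  define Y where "Y = X + int w"
  have AXY: "A = X + Y"
    using X Y_def by simp
  have "4 * (X * Y) = (A - int w) * (A + int w)"
    using X Y_def by (simp add: algebra_simps)
  also have "\<dots> = 4 * (int p * int q * int s ^ 4)"
    unfolding Aw[symmetric] by (simp add: power2_eq_square algebra_simps)
  finally have XY: "X * Y = int p * int q * int s ^ 4"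
    by simp
  \<comment> \<open>\<open>A\<close> may be negative; as \<open>X * Y > 0\<close>, both have the
    same sign and the absolute values add up to \<open>\<bar>A\<bar>\<close>.\<close>
  define x y where "x = nat \<bar>X\<bar>" and "y = nat \<bar>Y\<bar>"
  have xy: "x * y = p * q * s ^ 4"
  proof -
    have "int (x * y) = \<bar>X * Y\<bar>"
      by (simp add: x_def y_def abs_mult)
    also have "\<dots> = int (p * q * s ^ 4)"
      unfolding XY by simp
    finally show ?thesis
      by (simp only: of_nat_eq_iff)
  qed
  have "X * Y > 0"
    unfolding XY using pq \<open>s > 0\<close> by (simp add: prime_gt_0_nat)
  then have xyA: "int (x + y) = \<bar>A\<bar>"
    unfolding AXY x_def y_def by (auto simp: zero_less_mult_iff)
  have "coprime p q"
    using pq(1-3) by (simp add: primes_coprime)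
  then have sqf: "squarefree (p * q)"
    using pq(1,2) squarefree_mult_coprime squarefree_prime by blast
  \<comment> \<open>A common prime that misses \<open>s\<close> would have its square dividing the
    squarefree \<open>p * q\<close>; one that divides \<open>s\<close> also divides
    \<open>A = X + Y\<close>, hence \<open>r\<close>, against \<open>coprime r s\<close>.\<close>
  have "coprime x y"
  proof (rule ccontr)
    assume "\<not> coprime x y"
    then obtain l where l: "prime l" "l dvd x" "l dvd y"
      by (metis coprime_iff_gcd_eq_1 gcd_nat.bounded_iff prime_factor_nat)
    have "l dvd s"
    proof (rule ccontr)
      assume "\<not> l dvd s"
      then have "coprime (l\<^sup>2) (s ^ 4)"
        using l(1) by (simp add: prime_imp_coprime)
      moreover have "l\<^sup>2 dvd p * q * s ^ 4"
        unfolding xy[symmetric] power2_eq_square using l by (simp add: mult_dvd_mono)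
      ultimately have "l\<^sup>2 dvd p * q"
        by (simp add: coprime_dvd_mult_left_iff)
      from squarefreeD[OF sqf this] show False
        using l(1) not_prime_unit by blast
    qed
    moreover have "int l dvd A"
      using l unfolding AXY x_def y_def by (simp add: int_dvd_int_iff[symmetric])
    ultimately have "int l dvd A + 2 * (int p - 1) * (int s)\<^sup>2"
      by (simp add: dvd_add dvd_mult power2_eq_square)
    then have "int l dvd int (r\<^sup>2)"
      by (simp add: A_def)
    then have "l dvd r"
      using l(1) by (simp only: int_dvd_int_iff prime_dvd_power_iff pos2)
    then show False
      using \<open>l dvd s\<close> rs(4) l(1) by (metis coprime_common_divisor_nat not_prime_1)
  qed
  then obtain m n where mn: "s = m * n" "coprime m n"
    "x + y = m ^ 4 + p * q * n ^ 4 \<or> x + y = p * m ^ 4 + q * n ^ 4"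
    using coprime_mult_eq_two_primes_times_fourth_power[OF _ xy pq(1,2)] pq(3) by auto
  have "n > 0" "m > 0"
    using mn(1) \<open>s > 0\<close> by auto
  have "\<bar>A\<bar> = int m ^ 4 + int p * int q * int n ^ 4 \<or> \<bar>A\<bar> = int p * int m ^ 4 + int q * int n ^ 4"
    using mn(3) unfolding xyA[symmetric] by (metis of_nat_add of_nat_mult of_nat_power)
  moreover have "(int r)\<^sup>2 = 2 * (int p - 1) * (int m * int n)\<^sup>2 + A"
    by (simp add: A_def mn(1))
  moreover have "int p mod 8 = 7"
    using pq(4) by presburger
  ultimately obtain u' v' where
    uv: "u'\<^sup>2 = v'\<^sup>2 + 2 * (int n)\<^sup>2" "u'\<^sup>2 = (int m)\<^sup>2 + int p * (int n)\<^sup>2"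
    using descent_quartic[of "int p" "int q" "int r" "int m" "int n" A]
      pq(3) prime_gt_0_nat[OF pq(2)] rs(3) mn(2) \<open>n > 0\<close> by auto
  define u'' v'' where "u'' = nat \<bar>u'\<bar>" and "v'' = nat \<bar>v'\<bar>"
  have "int (u''\<^sup>2) = int (v''\<^sup>2 + 2 * n\<^sup>2)" "int (u''\<^sup>2) = int (m\<^sup>2 + p * n\<^sup>2)"
    using uv by (simp_all add: u''_def v''_def)
  then have uv'': "u''\<^sup>2 = v''\<^sup>2 + 2 * n\<^sup>2" "u''\<^sup>2 = m\<^sup>2 + p * n\<^sup>2"
    by (simp_all only: of_nat_eq_iff)
  have "coprime u'' n"
  proof (rule coprimeI)
    fix d assume d: "d dvd u''" "d dvd n"
    then have "d dvd u''\<^sup>2" "d dvd p * n\<^sup>2"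
      by (simp_all add: power2_eq_square)
    then have "d dvd m\<^sup>2"
      unfolding uv''(2) by (simp add: dvd_add_left_iff)
    moreover have "coprime (m\<^sup>2) n"
      using mn(2) by simp
    ultimately show "is_unit d"
      using d(2) coprime_common_divisor by blast
  qed
  moreover have "n < e"
  proof -
    have "e = n * (2 * r * m)"
      using rs(2) mn(1) by simp
    moreover have "2 * r * m > 1"
      using \<open>r > 0\<close> \<open>m > 0\<close> by (metis One_nat_def Suc_1 Suc_leI mult_le_mono mult.right_neutral lessI order_less_le_trans)
    ultimately show ?thesis
      using \<open>n > 0\<close> by simp
  qed
  \<comment> \<open>In the smaller solution \<open>m\<close> takes the place of
    \<open>w\<close>.\<close>
  ultimately show False
    using less.IH[of n u'' v'' m] \<open>n > 0\<close> uv'' by blast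
qed

section \<open>Rational points\<close>

lemma rat_square_eq_of_int:
  fixes z :: rat
  assumes "z\<^sup>2 = of_int N"
  obtains k where "z = of_int k"
proof -
  obtain c d where cd: "quotient_of z = (c, d)"
    by force
  then have z: "z = of_int c / of_int d" and d: "d > 0" "coprime c d"
    using quotient_of_div quotient_of_denom_pos quotient_of_coprime by blast+
  have "of_int (c\<^sup>2) = (of_int (N * d\<^sup>2) :: rat)"
    using assms d(1) unfolding z by (simp add: power_divide field_simps)
  then have "c\<^sup>2 = N * d\<^sup>2"
    by (simp only: of_int_eq_iff)
  then have "d\<^sup>2 dvd c\<^sup>2"
    by simp
  then have "d = 1"
    using d by (metis coprime_common_divisor dvd_refl pow_divides_pow_iff pos2 zdvd1_eq abs_of_pos)
  then show ?thesis
    using z that by simp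
qed

text \<open>With \<open>t = a / b\<close> the equation becomes \<open>A * M = k\<^sup>2\<close> for
  \<open>A = a\<^sup>2 - 2 * b\<^sup>2\<close> and \<open>M = a\<^sup>2 - p * b\<^sup>2\<close>. A
  common prime divides \<open>A - M = q * b\<^sup>2\<close> but not \<open>b\<close>, so it divides
  \<open>q\<close>. Modulo 8 it only remains that \<open>A\<close> and \<open>M\<close> are both
  squares, which \<open>no_concordant_squares\<close> excludes.\<close>

lemma no_point_with_square_abscissa:
  fixes p q :: nat and t y :: rat
  assumes pq: "prime p" "prime q" "p = q + 2" "p mod 8 = 7"
    and y: "y\<^sup>2 = t\<^sup>2 * (t\<^sup>2 - of_nat p) * (t\<^sup>2 - 2)" "y \<noteq> 0"
  shows False
proof -
  obtain a b where ab: "quotient_of t = (a, b)"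
    by force
  then have t: "t = of_int a / of_int b" and b: "b > 0" and cop: "coprime a b"
    using quotient_of_div quotient_of_denom_pos quotient_of_coprime by blast+
  define A M where "A = a\<^sup>2 - 2 * b\<^sup>2" and "M = a\<^sup>2 - int p * b\<^sup>2"
  have "t \<noteq> 0"
    using y by auto
  have tb: "rat_of_int a = t * rat_of_int b"
    using t b by simp
  have "(y / t * (of_int b)\<^sup>2)\<^sup>2 = of_int (A * M)"
  proof -
    have "(y / t * (of_int b)\<^sup>2)\<^sup>2 = (t\<^sup>2 - of_nat p) * (t\<^sup>2 - 2) * of_int b ^ 4"
      using \<open>t \<noteq> 0\<close> by (simp add: power_mult_distrib power_divide y(1) flip: power_mult)
    also have "\<dots> = ((t * of_int b)\<^sup>2 - 2 * (of_int b)\<^sup>2) * ((t * of_int b)\<^sup>2 - of_nat p * (of_int b)\<^sup>2)"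
      by (simp add: algebra_simps power2_eq_square power4_eq_xxxx)
    also have "\<dots> = of_int (A * M)"
      by (simp add: A_def M_def flip: tb)
    finally show ?thesis .
  qed
  then obtain k where k: "y / t * (of_int b)\<^sup>2 = of_int k"
    by (rule rat_square_eq_of_int)
  with \<open>(y / t * (of_int b)\<^sup>2)\<^sup>2 = of_int (A * M)\<close> have "of_int (A * M) = (of_int (k\<^sup>2) :: rat)"
    by simp
  then have AM: "A * M = k\<^sup>2"
    by (simp only: of_int_eq_iff)
  have "k \<noteq> 0"
    using k y(2) \<open>t \<noteq> 0\<close> b by auto
  have "r dvd int q" if r: "prime r" "r dvd A" "r dvd M" for r
  proof -
    have "r dvd A - M" using r by simp
    then have "r dvd int q * b\<^sup>2"
      by (simp add: A_def M_def pq(3) algebra_simps)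
    moreover have "\<not> r dvd b"
    proof
      assume "r dvd b"
      then have "r dvd A + 2 * b\<^sup>2" using r by (simp add: power2_eq_square)
      then have "r dvd a"
        using r(1) by (simp add: A_def prime_dvd_power_iff)
      then show False
        using \<open>r dvd b\<close> cop r(1) by (metis coprime_common_divisor not_prime_unit)
    qed
    ultimately show ?thesis
      using r(1) by (simp add: prime_dvd_mult_iff prime_dvd_power_iff)
  qed
  moreover have q: "int q > 0"
    using prime_gt_0_nat[OF pq(2)] by simp
  ultimately obtain d v where d: "d dvd int q" "d > 0" "\<bar>A\<bar> = d * v\<^sup>2"
    using square_class_int[OF AM \<open>k \<noteq> 0\<close>, of "int q"] q by blast
  have "d = 1 \<or> d = int q"
    using d(1,2) pq(2) by (metis prime_int_iff prime_nat_int_transfer less_imp_le)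
  \<comment> \<open>Excludes the residues 0, 0, 0, which would satisfy the congruences refuted
    below.\<close>
  have "odd a \<or> odd b"
    using cop by (metis coprime_common_divisor odd_one)
  then have sq: "a\<^sup>2 mod 8 \<in> {0,1,4}" "b\<^sup>2 mod 8 \<in> {0,1,4}" "v\<^sup>2 mod 8 \<in> {0,1,4}"
    "a\<^sup>2 mod 8 = 1 \<or> b\<^sup>2 mod 8 = 1"
    using odd_square_mod_8_int square_mod_8_int by blast+
  have "int p mod 8 = 7"
    using pq(4) by presburger
  then have pq8: "int p mod 8 = 7" "int q mod 8 = 5" "- int q mod 8 = 3"
    using pq(3) by presburger+
  \<comment> \<open>\<open>A\<close> may have either sign, so both \<open>q\<close> and
    \<open>- q\<close>, that is 5 and 3 modulo 8, have to be refuted as coefficients.\<close>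
  have "d = 1"
  proof (rule ccontr)
    have residues: "\<forall>i\<in>{0, 1, 4}. \<forall>j\<in>{0, 1, 4}. \<forall>k\<in>{0, 1, 4}. i = 1 \<or> j = 1 \<longrightarrow>
        i \<noteq> (2 * j + 5 * k) mod 8 \<and> i \<noteq> (2 * j + 3 * k) mod (8 :: int)"
      by simp
    assume "d \<noteq> 1"
    then have "\<bar>A\<bar> = int q * v\<^sup>2"
      using \<open>d = 1 \<or> d = int q\<close> d(3) by simp
    then have "a\<^sup>2 = 2 * b\<^sup>2 + int q * v\<^sup>2 \<or> a\<^sup>2 = 2 * b\<^sup>2 - int q * v\<^sup>2"
      unfolding A_def by linarith
    then have "a\<^sup>2 mod 8 = (2 * b\<^sup>2 + int q * v\<^sup>2) mod 8 \<or> a\<^sup>2 mod 8 = (2 * b\<^sup>2 - int q * v\<^sup>2) mod 8"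
      by auto
    moreover have "(2 * b\<^sup>2 + int q * v\<^sup>2) mod 8 = (2 * (b\<^sup>2 mod 8) + 5 * (v\<^sup>2 mod 8)) mod 8"
      by (rule linear_combination_mod_eq; (rule pq8 | simp))
    moreover have "2 * b\<^sup>2 - int q * v\<^sup>2 = 2 * b\<^sup>2 + (- int q) * v\<^sup>2"
      by simp
    moreover have "(2 * b\<^sup>2 + (- int q) * v\<^sup>2) mod 8 = (2 * (b\<^sup>2 mod 8) + 3 * (v\<^sup>2 mod 8)) mod 8"
      by (rule linear_combination_mod_eq; (rule pq8 | simp))
    moreover have "a\<^sup>2 mod 8 \<noteq> (2 * (b\<^sup>2 mod 8) + 5 * (v\<^sup>2 mod 8)) mod 8"
      "a\<^sup>2 mod 8 \<noteq> (2 * (b\<^sup>2 mod 8) + 3 * (v\<^sup>2 mod 8)) mod 8"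
      by (rule conjunct1[OF residues[rule_format, OF sq]] conjunct2[OF residues[rule_format, OF sq]])+
    ultimately show False
      by metis
  qed
  then have Av: "\<bar>A\<bar> = v\<^sup>2"
    using d by simp
  have "A \<noteq> 0" using AM \<open>k \<noteq> 0\<close> by auto
  then have "v \<noteq> 0" using Av by auto
  have "v\<^sup>2 dvd k\<^sup>2"
    unfolding AM[symmetric] Av[symmetric] by simp
  then obtain w where w: "k = v * w"
    by auto
  have "\<bar>A\<bar> * \<bar>M\<bar> = k\<^sup>2"
    using AM by (metis abs_mult abs_power2)
  then have Mw: "\<bar>M\<bar> = w\<^sup>2"
    using w Av \<open>v \<noteq> 0\<close> by (simp add: power_mult_distrib)
  have "A * M > 0"
    unfolding AM using \<open>k \<noteq> 0\<close> by simp
  then consider "A > 0" "M > 0" | "A < 0" "M < 0"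
    by (auto simp: zero_less_mult_iff)
  then show False
  proof cases
    case 1
    then have "a\<^sup>2 = v\<^sup>2 + 2 * b\<^sup>2" "a\<^sup>2 = w\<^sup>2 + int p * b\<^sup>2"
      using Av Mw by (simp_all add: A_def M_def)
    then have "int ((nat \<bar>a\<bar>)\<^sup>2) = int ((nat \<bar>v\<bar>)\<^sup>2 + 2 * (nat \<bar>b\<bar>)\<^sup>2)"
      "int ((nat \<bar>a\<bar>)\<^sup>2) = int ((nat \<bar>w\<bar>)\<^sup>2 + p * (nat \<bar>b\<bar>)\<^sup>2)"
      by simp_all
    then have "(nat \<bar>a\<bar>)\<^sup>2 = (nat \<bar>v\<bar>)\<^sup>2 + 2 * (nat \<bar>b\<bar>)\<^sup>2"
      "(nat \<bar>a\<bar>)\<^sup>2 = (nat \<bar>w\<bar>)\<^sup>2 + p * (nat \<bar>b\<bar>)\<^sup>2"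
      by (simp_all only: of_nat_eq_iff)
    moreover have "coprime (nat \<bar>a\<bar>) (nat \<bar>b\<bar>)" "nat \<bar>b\<bar> > 0"
      using cop b by simp_all
    ultimately show False
      using no_concordant_squares[OF pq] by blast
  next
    case 2
    have residues: "\<forall>i\<in>{0, 1, 4}. \<forall>j\<in>{0, 1, 4}. \<forall>k\<in>{0, 1, 4}. i = 1 \<or> j = 1 \<longrightarrow>
        (i + k) mod 8 \<noteq> (7 * j) mod (8 :: int)"
      by simp
    from 2 have "a\<^sup>2 + w\<^sup>2 = int p * b\<^sup>2"
      using Mw by (simp add: M_def)
    then have "(a\<^sup>2 + w\<^sup>2) mod 8 = (int p * b\<^sup>2) mod 8"
      by simp
    moreover have "(a\<^sup>2 + w\<^sup>2) mod 8 = (a\<^sup>2 mod 8 + w\<^sup>2 mod 8) mod 8"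
      by (rule mod_add_eq[symmetric])
    moreover have "(int p * b\<^sup>2) mod 8 = (7 * (b\<^sup>2 mod 8)) mod 8"
      unfolding pq8(1)[symmetric] by (rule mod_mult_eq[symmetric])
    moreover have "(a\<^sup>2 mod 8 + w\<^sup>2 mod 8) mod 8 \<noteq> (7 * (b\<^sup>2 mod 8)) mod 8"
      by (rule residues[rule_format, OF sq(1,2) square_mod_8_int sq(4)])
    ultimately show False
      by metis
  qed
qed

text \<open>With \<open>x = a / b\<close> the equation becomes
  \<open>a * b * (a - p * b) * (a - 2 * b) = k\<^sup>2\<close>. A prime common to \<open>a\<close>
  and the remaining factors divides \<open>p * b\<close> or \<open>2 * b\<close> but not
  \<open>b\<close>, so it divides \<open>2 * p\<close>. The sign is fixed by \<open>x > 0\<close>: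
  otherwise the cubic would be at most 0, while \<open>y\<^sup>2 > 0\<close>.\<close>

lemma abscissa_square_class:
  fixes p :: nat and x y :: rat
  assumes "p > 2" and y: "y\<^sup>2 = x * (x - of_nat p) * (x - 2)" "y \<noteq> 0"
  obtains d t where "d dvd 2 * int p" "d > 0" "x = of_int d * t\<^sup>2"
proof -
  obtain a b where ab: "quotient_of x = (a, b)"
    by force
  then have x: "x = of_int a / of_int b" and b: "b > 0" and cop: "coprime a b"
    using quotient_of_div quotient_of_denom_pos quotient_of_coprime by blast+
  have xb: "of_int a = x * of_int b"
    using x b by simp
  have "x > 0"
  proof (rule ccontr)
    assume "\<not> x > 0"
    then have "x - of_nat p < 0" "x - 2 < 0"
      using assms(1) by (simp_all add: order.strict_trans1)
    then have "x * (x - of_nat p) * (x - 2) \<le> 0"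
      using \<open>\<not> x > 0\<close> by (simp add: mult_nonneg_nonpos mult_nonpos_nonpos)
    then show False
      using y by (metis zero_less_power2 not_le)
  qed
  then have "a > 0"
    using x b by (simp add: zero_less_divide_iff)
  define c1 c2 where "c1 = a - int p * b" and "c2 = a - 2 * b"
  have yb: "(y * (of_int b)\<^sup>2)\<^sup>2 = of_int (a * b * c1 * c2)"
    unfolding power_mult_distrib y(1)
    by (simp add: c1_def c2_def xb algebra_simps power2_eq_square)
  then obtain k where k: "y * (of_int b)\<^sup>2 = of_int k"
    by (rule rat_square_eq_of_int)
  with yb have "of_int (a * b * c1 * c2) = (of_int (k\<^sup>2) :: rat)"
    by simp
  then have abc: "a * b * c1 * c2 = k\<^sup>2"
    by (simp only: of_int_eq_iff)
  have "k \<noteq> 0"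
    using k y(2) b by auto
  have ndvd: "\<not> (r dvd a \<and> r dvd b)" if "prime r" for r
    using cop that by (metis coprime_common_divisor not_prime_unit)
  \<comment> \<open>The bound 1 leaves only the trivial square class, so \<open>b\<close> is itself
    a square.\<close>
  have b_class: "r dvd 1" if r: "prime r" "r dvd b" "r dvd a * c1 * c2" for r
  proof -
    have "r dvd a \<or> r dvd c1 \<or> r dvd c2"
      using r by (simp add: prime_dvd_mult_iff)
    then have "r dvd a"
      using r(2) unfolding c1_def c2_def by (metis diff_add_cancel dvd_add dvd_mult)
    then show ?thesis
      using ndvd r by blast
  qed
  have a_class: "r dvd 2 * int p" if r: "prime r" "r dvd a" "r dvd b * c1 * c2" for r
  proof -
    have "\<not> r dvd b"
      using ndvd r by blast
    have "r dvd c1 \<or> r dvd c2"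
      using r \<open>\<not> r dvd b\<close> by (simp add: prime_dvd_mult_iff)
    then have "r dvd int p * b \<or> r dvd 2 * b"
      using r(2) unfolding c1_def c2_def by (metis diff_diff_eq2 add_diff_cancel_left' dvd_diff)
    then show ?thesis
      using \<open>\<not> r dvd b\<close> r(1) by (auto simp: prime_dvd_mult_iff)
  qed
  have "b * (a * c1 * c2) = k\<^sup>2" "a * (b * c1 * c2) = k\<^sup>2"
    using abc by (simp_all add: mult_ac)
  from square_class_int[OF this(1) \<open>k \<noteq> 0\<close> _ b_class]
  obtain v where v: "b = v\<^sup>2"
    using b by auto
  from square_class_int[OF \<open>a * (b * c1 * c2) = k\<^sup>2\<close> \<open>k \<noteq> 0\<close> _ a_class]
  obtain d u where d: "d dvd 2 * int p" "d > 0" "a = d * u\<^sup>2"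
    using \<open>a > 0\<close> assms(1) by auto
  have "x = of_int d * (of_int u / of_int v)\<^sup>2"
    using x v d(3) by (simp add: power_divide)
  then show ?thesis
    using that d by blast
qed

lemma dvd_two_times_primeE:
  fixes d p :: int
  assumes "d dvd 2 * p" "d > 0" "prime p"
  shows "d \<in> {1, 2, p, 2 * p}"
proof -
  obtain b c where bc: "d = b * c" "b dvd 2" "c dvd p"
    using division_decomp[OF assms(1)] by blast
  have "d = \<bar>b\<bar> * \<bar>c\<bar>"
    using bc(1) assms(2) by (metis abs_mult abs_of_pos)
  moreover have "\<bar>b\<bar> = 1 \<or> \<bar>b\<bar> = 2"
    using bc(2) two_is_prime_nat by (metis abs_dvd_iff abs_ge_zero prime_int_iff prime_int_numeral_eq two_is_prime_nat)
  moreover have "\<bar>c\<bar> = 1 \<or> \<bar>c\<bar> = p"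
    using bc(3) assms(3) by (metis abs_dvd_iff abs_ge_zero prime_int_iff)
  ultimately show ?thesis
    by auto
qed

text \<open>For the translates in \<open>ordinate_eq_0\<close>: the new abscissa and its differences
  with \<open>p\<close> and 2 share the denominator \<open>z\<close>, so the curve equation becomes
  an identity between numerators.\<close>

lemma square_of_quotient_eq:
  fixes z k y a b c :: rat
  assumes "z \<noteq> 0" "a * b * c * z = (k * y)\<^sup>2"
  shows "(k * y / z\<^sup>2)\<^sup>2 = a / z * (b / z) * (c / z)"
proof -
  have "(k * y / z\<^sup>2)\<^sup>2 = a * b * c * z / z ^ 4"
    by (simp add: power_divide assms(2) flip: power_mult)
  also have "\<dots> = a / z * (b / z) * (c / z)"
    using assms(1) by (simp add: power4_eq_xxxx)
  finally show ?thesis .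
qed

text \<open>The translates of a point with abscissa \<open>x\<close> by \<open>(0, 0)\<close>, \<open>(2, 0)\<close>, \<open>(p, 0)\<close> have the abscissae
  \<open>2p/x\<close>, \<open>2(x - p)/(x - 2)\<close>, \<open>p(x - 2)/(x - p)\<close>; one of these is a square unless \<open>x\<close> is.\<close>

lemma ordinate_eq_0:
  fixes p q :: nat and x y :: rat
  assumes pq: "prime p" "prime q" "p = q + 2" "p mod 8 = 7"
    and y: "y\<^sup>2 = x * (x - of_nat p) * (x - 2)"
  shows "y = 0"
proof (rule ccontr)
  assume "y \<noteq> 0"
  have "p > 2"
    using pq(2,3) by (simp add: prime_gt_0_nat)
  obtain d t where d: "d dvd 2 * int p" "d > 0" "x = of_int d * t\<^sup>2"
    using abscissa_square_class[OF \<open>p > 2\<close> y \<open>y \<noteq> 0\<close>] by blast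
  have nz: "x \<noteq> 0" "x - of_nat p \<noteq> 0" "x - 2 \<noteq> 0"
    using y \<open>y \<noteq> 0\<close> by auto
  have "t \<noteq> 0"
    using nz d by auto
  have pos: "rat_of_nat p \<noteq> 0" "rat_of_nat q \<noteq> 0" "rat_of_nat p = rat_of_nat q + 2"
    using pq by (auto simp: prime_gt_0_nat)
  have false: False if x': "x' = t'\<^sup>2" "y' \<noteq> 0" "y'\<^sup>2 = x' * (x' - of_nat p) * (x' - 2)" for x' y' t' :: rat
    using no_point_with_square_abscissa[OF pq, of y' t'] x' by simp
  consider "d = 1" | "d = 2" | "d = int p" | "d = 2 * int p"
    using dvd_two_times_primeE[OF d(1,2)] pq(1) by auto
  then show False
  proof cases
    case 1
    then show False
      using false[of x t y] d(3) y \<open>y \<noteq> 0\<close> by simp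
  next
    case 2
    let ?z = "x - 2"
    \<comment> \<open>Translation by \<open>(2, 0)\<close>; the cases \<open>d = p\<close> and
      \<open>d = 2 * p\<close> use \<open>(p, 0)\<close> and \<open>(0, 0)\<close>.
      \<open>y'\<close> is the ordinate of the translate up to sign.\<close>
    define x' y' where "x' = 2 * (x - of_nat p) / ?z" and "y' = 2 * of_nat q * y / ?z\<^sup>2"
    \<comment> \<open>Dividing the curve equation by \<open>(x - 2)\<^sup>2 * t\<^sup>2\<close>
      leaves \<open>x / t\<^sup>2 = 2\<close> as the factor that turns
      \<open>(x - p) / (x - 2)\<close> into \<open>x'\<close>.\<close>
    have "x' = (y / (?z * t))\<^sup>2"
    proof -
      have "(y / (?z * t))\<^sup>2 = x * (x - of_nat p) * ?z / (?z\<^sup>2 * t\<^sup>2)"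
        by (simp add: power_divide power_mult_distrib y)
      also have "\<dots> = x / t\<^sup>2 * (x - of_nat p) / ?z"
        using nz by (simp add: power2_eq_square)
      also have "x / t\<^sup>2 = 2"
        using d(3) 2 \<open>t \<noteq> 0\<close> by simp
      finally show ?thesis
        by (simp add: x'_def)
    qed
    moreover have "y' \<noteq> 0"
      using nz pos \<open>y \<noteq> 0\<close> by (simp add: y'_def)
    moreover have "y'\<^sup>2 = x' * (x' - of_nat p) * (x' - 2)"
    proof -
      have "x' - of_nat p = - of_nat q * x / ?z" "x' - 2 = - 2 * of_nat q / ?z"
        unfolding x'_def pos(3) using nz(3) by (simp_all add: field_simps)
      moreover have "2 * (x - of_nat p) * (- of_nat q * x) * (- 2 * of_nat q) * ?z = (2 * of_nat q * y)\<^sup>2"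
        unfolding power_mult_distrib y by (simp add: power2_eq_square algebra_simps)
      ultimately show ?thesis
        unfolding x'_def y'_def using square_of_quotient_eq[OF nz(3)] by metis
    qed
    ultimately show False
      by (rule false)
  next
    case 3
    let ?z = "x - of_nat p"
    define x' y' where "x' = of_nat p * (x - 2) / ?z" and "y' = of_nat p * of_nat q * y / ?z\<^sup>2"
    have "x' = (y / (?z * t))\<^sup>2"
    proof -
      have "(y / (?z * t))\<^sup>2 = x * ?z * (x - 2) / (?z\<^sup>2 * t\<^sup>2)"
        by (simp add: power_divide power_mult_distrib y)
      also have "\<dots> = x / t\<^sup>2 * (x - 2) / ?z"
        using nz by (simp add: power2_eq_square)
      also have "x / t\<^sup>2 = of_nat p"
        using d(3) 3 \<open>t \<noteq> 0\<close> by simp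
      finally show ?thesis
        by (simp add: x'_def)
    qed
    moreover have "y' \<noteq> 0"
      using nz pos \<open>y \<noteq> 0\<close> by (simp add: y'_def)
    moreover have "y'\<^sup>2 = x' * (x' - of_nat p) * (x' - 2)"
    proof -
      have "x' - of_nat p = of_nat p * of_nat q / ?z" "x' - 2 = of_nat q * x / ?z"
        unfolding x'_def using nz(2) pos(3) by (simp_all add: field_simps)
      moreover have "of_nat p * (x - 2) * (of_nat p * of_nat q) * (of_nat q * x) * ?z = (of_nat p * of_nat q * y)\<^sup>2"
        unfolding power_mult_distrib y by (simp add: power2_eq_square algebra_simps)
      ultimately show ?thesis
        unfolding x'_def y'_def using square_of_quotient_eq[OF nz(2)] by metis
    qed
    ultimately show False
      by (rule false)
  next
    case 4
    define x' y' where "x' = 2 * of_nat p / x" and "y' = 2 * of_nat p * y / x\<^sup>2"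
    have "x' = (1 / t)\<^sup>2"
      using d(3) 4 pos(1) \<open>t \<noteq> 0\<close> by (simp add: x'_def power_divide)
    moreover have "y' \<noteq> 0"
      using nz pos \<open>y \<noteq> 0\<close> by (simp add: y'_def)
    moreover have "y'\<^sup>2 = x' * (x' - of_nat p) * (x' - 2)"
    proof -
      have "x' - of_nat p = - of_nat p * (x - 2) / x" "x' - 2 = - 2 * (x - of_nat p) / x"
        unfolding x'_def using nz(1) by (simp_all add: field_simps)
      moreover have "2 * of_nat p * (- of_nat p * (x - 2)) * (- 2 * (x - of_nat p)) * x = (2 * of_nat p * y)\<^sup>2"
        unfolding power_mult_distrib y by (simp add: power2_eq_square algebra_simps)
      ultimately show ?thesis
        unfolding x'_def y'_def using square_of_quotient_eq[OF nz(1)] by metis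
    qed
    ultimately show False
      by (rule false)
  qed
qed

section \<open>The group structure\<close>

lemma E_group_iso_if_ec_points:
  fixes p :: nat
  assumes p: "p \<noteq> 0" "p \<noteq> 2"
    and pts: "ec_points (E_cubic p) = {Infinity, Affine 0 0, Affine 2 0, Affine (of_nat p) 0}"
  shows "E_group p \<cong> integer_mod_group 2 \<times>\<times> integer_mod_group 2"
proof -
  have ne: "rat_of_nat p \<noteq> 0" "rat_of_nat p \<noteq> 2" "2 \<noteq> rat_of_nat p" "0 \<noteq> rat_of_nat p"
    using p of_nat_eq_iff[of p 2, where ?'a = rat] by auto
  \<comment> \<open>Minus the sum of the roots: the chord through two distinct points with
    \<open>y = 0\<close> has slope 0, so the third abscissa is the remaining root.\<close>
  have c2: "coeff (E_cubic p) 2 = - of_nat p - 2"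
    by (simp add: E_cubic_def numeral_2_eq_2)
  \<comment> \<open>Any bijection sending \<open>Infinity\<close> to \<open>(0, 0)\<close> would do:
    each point is its own inverse, and two distinct affine points add up to the third.\<close>
  define h :: "rat ec_point \<Rightarrow> int \<times> int" where
    "h P = (if P = Infinity then (0, 0) else if P = Affine 0 0 then (1, 0)
            else if P = Affine 2 0 then (0, 1) else (1, 1))" for P
  have "h \<in> hom (E_group p) (integer_mod_group 2 \<times>\<times> integer_mod_group 2)"
    unfolding hom_def using ne
    by (auto simp: ec_group_def pts h_def c2 carrier_integer_mod_group Let_def)
  moreover have "bij_betw h (carrier (E_group p)) (carrier (integer_mod_group 2 \<times>\<times> integer_mod_group 2))"
  proof -
    have "{0..<2::int} = {0, 1}" by auto
    then show ?thesis
      unfolding bij_betw_def inj_on_def using ne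
      by (auto simp: ec_group_def pts h_def carrier_integer_mod_group)
  qed
  ultimately show ?thesis
    by (auto simp: is_iso_def iso_def)
qed

text \<open>\<open>THE\<close> demands existence and uniqueness. For \<open>r = 0\<close> the free
  factor is a single point; for \<open>r > 0\<close> it is infinite, whereas the carrier is
  finite.\<close>

lemma group_rank_eq_0_if_finite:
  fixes G :: "('a, 'b) monoid_scheme"
  assumes fin: "finite (carrier G)" and one: "\<one>\<^bsub>G\<^esub> \<in> carrier G"
    and tors: "torsion_carrier G = carrier G"
  shows "group_rank G = 0"
  unfolding group_rank_def
proof (rule the_equality)
  \<comment> \<open>The empty product has the single element \<open>\<lambda>_. undefined\<close>,
    the extensional function on the empty set.\<close>
  have "(\<lambda>x. (\<lambda>_. undefined, x)) \<in> iso G (product_group {..<0::nat} (\<lambda>_. integer_group) \<times>\<times> torsion_group G)"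
    by (auto simp: iso_def hom_def torsion_group_def tors product_group_def bij_betw_def inj_on_def restrict_def)
  then show "G \<cong> product_group {..<0::nat} (\<lambda>_. integer_group) \<times>\<times> torsion_group G"
    by (auto simp: is_iso_def)
next
  fix r :: nat
  assume "G \<cong> product_group {..<r} (\<lambda>_. integer_group) \<times>\<times> torsion_group G"
  then obtain h where "bij_betw h (carrier G)
      (carrier (product_group {..<r} (\<lambda>_. integer_group) \<times>\<times> torsion_group G))"
    by (auto simp: is_iso_def iso_def)
  then have "finite (({..<r} \<rightarrow>\<^sub>E (UNIV::int set)) \<times> carrier G)"
    using fin by (simp add: bij_betw_finite torsion_group_def tors)
  then have f: "finite ({..<r} \<rightarrow>\<^sub>E (UNIV::int set))"
    using one finite_cartesian_productD1 by blast
  show "r = 0"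
  proof (rule ccontr)
    assume "r \<noteq> 0"
    \<comment> \<open>Evaluation at index 0 maps the free factor onto all integers.\<close>
    have "x \<in> (\<lambda>f. f 0) ` ({..<r} \<rightarrow>\<^sub>E (UNIV::int set))" for x
      using \<open>r \<noteq> 0\<close> by (intro image_eqI[of _ _ "restrict (\<lambda>_. x) {..<r}"]) auto
    then have "(\<lambda>f. f 0) ` ({..<r} \<rightarrow>\<^sub>E (UNIV::int set)) = UNIV"
      by blast
    then show False
      using f finite_imageI infinite_UNIV_int by metis
  qed
qed

theorem theorem1:
  fixes p :: nat
  assumes "prime p" and "prime (p - 2)" and "[p = 7] (mod 8)"
  shows "group_rank (E_group p) = 0
    \<and> E_group p \<cong> integer_mod_group 2 \<times>\<times> integer_mod_group 2"
proof -
  \<comment> \<open>Subtraction on \<open>nat\<close> truncates; primality of \<open>p - 2\<close>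
    makes it positive, so that \<open>p = (p - 2) + 2\<close> really holds.\<close>
  have "p - 2 > 0"
    using assms(2) prime_gt_0_nat by blast
  then have p: "p = (p - 2) + 2" "p \<noteq> 0" "p \<noteq> 2"
    by auto
  have p8: "p mod 8 = 7"
    using assms(3) by (simp add: cong_def)
  have "x = 0 \<or> x = 2 \<or> x = of_nat p" "y = 0" if "y\<^sup>2 = poly (E_cubic p) x" for x y
  proof -
    show "y = 0"
      using ordinate_eq_0[OF assms(1,2) p(1) p8] that by (simp add: poly_E_cubic)
    then show "x = 0 \<or> x = 2 \<or> x = of_nat p"
      using that by (auto simp: poly_E_cubic)
  qed
  then have pts: "ec_points (E_cubic p) = {Infinity, Affine 0 0, Affine 2 0, Affine (of_nat p) 0}"
    unfolding ec_points_def by (auto simp: poly_E_cubic)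
  have double: "P \<otimes>\<^bsub>E_group p\<^esub> P = \<one>\<^bsub>E_group p\<^esub>" if "P \<in> carrier (E_group p)" for P
    using that by (auto simp: ec_group_def pts)
  have "torsion_carrier (E_group p) = carrier (E_group p)"
  proof -
    have "P [^]\<^bsub>E_group p\<^esub> (2::nat) = \<one>\<^bsub>E_group p\<^esub>" if "P \<in> carrier (E_group p)" for P
    proof -
      \<comment> \<open>Powers are built by right multiplication starting from the unit, which the
        first equation of \<open>ec_add\<close> then removes.\<close>
      have "P [^]\<^bsub>E_group p\<^esub> (2::nat) = (\<one>\<^bsub>E_group p\<^esub> \<otimes>\<^bsub>E_group p\<^esub> P) \<otimes>\<^bsub>E_group p\<^esub> P"
        by (simp add: nat_pow_def numeral_2_eq_2)
      also have "\<one>\<^bsub>E_group p\<^esub> \<otimes>\<^bsub>E_group p\<^esub> P = P"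
        by (simp add: ec_group_def)
      finally show ?thesis
        using double[OF that] by simp
    qed
    then show ?thesis
      unfolding torsion_carrier_def by (auto intro!: exI[of _ "2::nat"])
  qed
  then have "group_rank (E_group p) = 0"
    by (intro group_rank_eq_0_if_finite) (simp_all add: ec_group_def pts)
  then show ?thesis
    using E_group_iso_if_ec_points[OF p(2,3) pts] by blast
qed

end
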